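(* Let $m,n\ge1$ and let $A$ be a real symmetric positive-definite $n\times n$ matrix. Suppose $B:\mathbb{R}_+^m\to\mathbb{R}_+$ is twice differentiable, increasing in each variable, and that there exists $\lambda\ge0$ such that $$D^2B(x)\le\lambda\,\operatorname{diag}\left(\frac{\partial_1B(x)}{x_1},\dots,\frac{\partial_mB(x)}{x_m}\right)\qquad\text{for all }x\in\mathbb{R}_+^m.$$ If $u_j:\mathbb{R}_+\times\mathbb{R}^n\to\mathbb{R}_+$ satisfies $$\partial_tu_j\ge\operatorname{div}(A^{-1}\nabla u_j)\quad\text{and}\quad D^2(\log u_j)\ge-\frac{A}{2t}$$ for all $j=1,\dots,m$, then $\widetilde u:=t^{\frac{\lambda n}{2}}B(u_1,\dots,u_m)$ satisfies $$\partial_t\widetilde u\ge\frac{1}{1+\lambda}\operatorname{div}(A^{-1}\nabla\widetilde u).$$ Moreover, if the function $\Theta:\mathbb{R}^m\to\mathbb{R}$ given by $\Theta(x_1,\dots,x_m):=\log B(e^{x_1},\dots,e^{x_m})$ is convex, then $$\frac{1}{1+\lambda}D^2(\log\widetilde u)\ge-\frac{A}{2t}.$$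
   Context: $\mathbb{R}_+=(0,\infty)$. Functions $u(t,x)$ have time variable $t\in\mathbb{R}_+$ and space variable $x\in\mathbb{R}^n$; $\operatorname{div}$, $\nabla$ and the Hessian $D^2$ of functions of $(t,x)$ act in the space variable $x$ only, while $D^2B$ is the Hessian of $B$ on $\mathbb{R}_+^m$. All functions $u_j$ are assumed sufficiently regular (once continuously differentiable in $t$ and twice continuously differentiable in $x$). "Increasing in each variable" means nondecreasing, i.e. $\partial_jB\ge0$ for each $j$. Matrix inequalities $P\ge Q$ mean that $P-Q$ is positive semidefinite, and inequalities are required or asserted at every point $(t,x)\in\mathbb{R}_+\times\mathbb{R}^n$. *)

theory Defs
  imports "HOL-Analysis.Analysis"
begin

definition partial_derivative :: "'n::finite \<Rightarrow> (real^'n \<Rightarrow> real) \<Rightarrow> real^'n \<Rightarrow> real" where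
  "partial_derivative i f x = deriv (\<lambda>s. f (x + s *\<^sub>R axis i 1)) 0"

definition gradient :: "(real^'n::finite \<Rightarrow> real) \<Rightarrow> real^'n \<Rightarrow> real^'n" where
  "gradient f x = (\<chi> i. partial_derivative i f x)"

definition divergence :: "(real^'n::finite \<Rightarrow> real^'n) \<Rightarrow> real^'n \<Rightarrow> real" where
  "divergence F x = (\<Sum>i\<in>UNIV. partial_derivative i (\<lambda>y. F y $ i) x)"

definition hessian :: "(real^'n::finite \<Rightarrow> real) \<Rightarrow> real^'n \<Rightarrow> real^'n^'n" where
  "hessian f x = (\<chi> i j. partial_derivative i (partial_derivative j f) x)"

text \<open>Frechet differentiability of \<open>f\<close> and of its gradient at every point of \<open>S\<close>;
  only used for open \<open>S\<close>. The Hessian need not be continuous.\<close>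

definition twice_differentiable_on :: "(real^'n::finite \<Rightarrow> real) \<Rightarrow> (real^'n) set \<Rightarrow> bool" where
  "twice_differentiable_on f S \<longleftrightarrow>
     (\<forall>x\<in>S. f differentiable (at x) \<and> gradient f differentiable (at x))"

definition C2_differentiable_on :: "(real^'n::finite \<Rightarrow> real) \<Rightarrow> (real^'n) set \<Rightarrow> bool" where
  "C2_differentiable_on f S \<longleftrightarrow> twice_differentiable_on f S \<and> continuous_on S (hessian f)"

definition symmetric_matrix :: "real^'n^'n::finite \<Rightarrow> bool" where
  "symmetric_matrix P \<longleftrightarrow> transpose P = P"

definition positive_definite :: "real^'n^'n::finite \<Rightarrow> bool" where
  "positive_definite P \<longleftrightarrow> symmetric_matrix P \<and> (\<forall>v. v \<noteq> 0 \<longrightarrow> 0 < v \<bullet> (P *v v))"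

definition positive_semidefinite :: "real^'n^'n::finite \<Rightarrow> bool" where
  "positive_semidefinite P \<longleftrightarrow> symmetric_matrix P \<and> (\<forall>v. 0 \<le> v \<bullet> (P *v v))"

text \<open>The library's \<open>\<le>\<close> on \<open>real^'n^'n\<close> compares entrywise, so the order by positive
  semidefiniteness needs its own symbol.\<close>

definition psd_le :: "real^'n^'n::finite \<Rightarrow> real^'n^'n \<Rightarrow> bool" (infix "\<le>\<^sub>p\<^sub>s\<^sub>d" 50) where
  "P \<le>\<^sub>p\<^sub>s\<^sub>d Q \<longleftrightarrow> positive_semidefinite (Q - P)"

definition diag_matrix :: "real^'n \<Rightarrow> real^'n^'n::finite" where
  "diag_matrix d = (\<chi> i j. if i = j then d $ i else 0)"

definition positive_orthant :: "(real^'m::finite) set" where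
  "positive_orthant = {x. \<forall>j. 0 < x $ j}"

end

theory Submission
  imports Defs
begin

text \<open>
The Hessian of \<open>B \<circ> u\<close> is \<open>transpose J ** D\<^sup>2B ** J + (\<Sum>j\<in>UNIV. \<partial>\<^sub>jB *\<^sub>R D\<^sup>2u\<^sub>j)\<close>, where \<open>J\<close> has the rows
\<open>\<nabla>u\<^sub>j\<close> (lemma \<open>has_grad_hess_compose\<close>).  Both conclusions come from estimating the quadratic terms in
the gradients by second derivatives and comparing the error with \<open>B\<close>.

For the differential inequality, take the Frobenius product with \<open>C = A\<^sup>-\<^sup>1\<close>, which turns Hessians into
\<open>div (A\<^sup>-\<^sup>1 \<nabla> _)\<close>.  Since Frobenius products of positive semidefinite matrices are nonnegative
(\<open>positive_semidefinite_inner_nonneg\<close>), the bound on \<open>D\<^sup>2B\<close> gives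
\<open>C \<bullet> (transpose J ** D\<^sup>2B ** J) \<le> \<lambda> \<Sum>\<^sub>j \<partial>\<^sub>jB / u\<^sub>j * (\<nabla>u\<^sub>j \<bullet> C \<nabla>u\<^sub>j)\<close>, and the lower bound on
\<open>D\<^sup>2 (log u\<^sub>j)\<close> gives \<open>(\<nabla>u\<^sub>j \<bullet> C \<nabla>u\<^sub>j) / u\<^sub>j \<le> div (C \<nabla>u\<^sub>j) + n u\<^sub>j / (2t)\<close>.  Thus \<open>div (C \<nabla>(B \<circ> u))\<close> is at
most \<open>(1 + \<lambda>) \<Sum>\<^sub>j \<partial>\<^sub>jB * div (C \<nabla>u\<^sub>j)\<close> plus the error \<open>\<lambda> n / (2t) * \<Sum>\<^sub>j u\<^sub>j \<partial>\<^sub>jB\<close>.  The derivative of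
the power of \<open>t\<close> contributes \<open>\<lambda> n / (2t) * B\<close>, and it compensates the error because
\<open>\<Sum>\<^sub>j x\<^sub>j \<partial>\<^sub>jB \<le> (1 + \<lambda>) B\<close>.  This Euler type inequality (\<open>diagonal_hessian_bound_imp_euler\<close>) is
where the positivity of \<open>B\<close> on whole rays enters.

For the logarithmic Hessian, convexity of \<open>\<Theta>\<close> is spelled out in terms of \<open>B\<close>
(\<open>log_convex_second_order\<close>) in the direction \<open>p = J *v w\<close>.  As a lower
bound for the quadratic form of the Hessian of \<open>log (B \<circ> u)\<close> at \<open>w\<close> it leaves
\<open>\<Sum>\<^sub>j \<partial>\<^sub>jB * (w \<bullet> D\<^sup>2u\<^sub>j w - p\<^sub>j\<^sup>2 / u\<^sub>j) / B = \<Sum>\<^sub>j (u\<^sub>j \<partial>\<^sub>jB / B) * (w \<bullet> D\<^sup>2 (log u\<^sub>j) w)\<close>;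
the weights are nonnegative and, again by the Euler type inequality, have sum at most \<open>1 + \<lambda>\<close>.
\<close>

section \<open>The Frobenius product and positive semidefinite matrices\<close>

lemma matrix_inner_sums: "P \<bullet> Q = (\<Sum>i\<in>UNIV. \<Sum>j\<in>UNIV. P $ i $ j * Q $ i $ j)"
  for P Q :: "real^'n^'m"
  by (simp add: inner_vec_def)

lemma symmetric_matrix_iff: "symmetric_matrix P \<longleftrightarrow> (\<forall>i j. P $ i $ j = P $ j $ i)"
  by (auto simp: symmetric_matrix_def transpose_def vec_eq_iff)

definition outer :: "real^'n \<Rightarrow> real^'m \<Rightarrow> real^'m^'n" where
  "outer v w = (\<chi> i j. v $ i * w $ j)"

lemma outer_mult_vector: "outer v w *v x = (w \<bullet> x) *\<^sub>R v"
  by (simp add: outer_def matrix_vector_mult_def vec_eq_iff inner_vec_def sum_distrib_left mult_ac)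

lemma inner_outer: "P \<bullet> outer v w = v \<bullet> (P *v w)"
  by (simp add: outer_def matrix_inner_sums matrix_vector_mult_def inner_vec_def
      sum_distrib_left mult_ac)

lemma inner_matrix_mult_left: "P \<bullet> (X ** Y) = (transpose X ** P) \<bullet> Y"
  for P :: "real^'n^'m" and X :: "real^'k^'m" and Y :: "real^'n^'k"
proof -
  have "P \<bullet> (X ** Y) = (\<Sum>i\<in>UNIV. \<Sum>j\<in>UNIV. \<Sum>k\<in>UNIV. X $ i $ k * P $ i $ j * Y $ k $ j)"
    by (simp add: matrix_inner_sums matrix_matrix_mult_def sum_distrib_left mult_ac)
  also have "\<dots> = (\<Sum>i\<in>UNIV. \<Sum>k\<in>UNIV. \<Sum>j\<in>UNIV. X $ i $ k * P $ i $ j * Y $ k $ j)"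
    by (rule sum.cong[OF refl], rule sum.swap)
  also have "\<dots> = (\<Sum>k\<in>UNIV. \<Sum>i\<in>UNIV. \<Sum>j\<in>UNIV. X $ i $ k * P $ i $ j * Y $ k $ j)"
    by (rule sum.swap)
  also have "\<dots> = (\<Sum>k\<in>UNIV. \<Sum>j\<in>UNIV. \<Sum>i\<in>UNIV. X $ i $ k * P $ i $ j * Y $ k $ j)"
    by (rule sum.cong[OF refl], rule sum.swap)
  finally show ?thesis
    by (simp add: matrix_inner_sums matrix_matrix_mult_def transpose_def sum_distrib_right)
qed

lemma inner_matrix_mult_right: "P \<bullet> (X ** Y) = (P ** transpose Y) \<bullet> X"
  for P :: "real^'n^'m" and X :: "real^'k^'m" and Y :: "real^'n^'k"
proof -
  have "P \<bullet> (X ** Y) = (\<Sum>i\<in>UNIV. \<Sum>j\<in>UNIV. \<Sum>k\<in>UNIV. X $ i $ k * P $ i $ j * Y $ k $ j)"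
    by (simp add: matrix_inner_sums matrix_matrix_mult_def sum_distrib_left mult_ac)
  also have "\<dots> = (\<Sum>i\<in>UNIV. \<Sum>k\<in>UNIV. \<Sum>j\<in>UNIV. X $ i $ k * P $ i $ j * Y $ k $ j)"
    by (rule sum.cong[OF refl], rule sum.swap)
  finally show ?thesis
    by (simp add: matrix_inner_sums matrix_matrix_mult_def transpose_def sum_distrib_left mult_ac)
qed

lemma positive_semidefiniteD:
  assumes "positive_semidefinite P"
  shows "P $ i $ j = P $ j $ i" "0 \<le> v \<bullet> (P *v v)" "v \<bullet> (P *v w) = (P *v v) \<bullet> w"
proof -
  show "P $ i $ j = P $ j $ i" "0 \<le> v \<bullet> (P *v v)"
    using assms by (auto simp: positive_semidefinite_def symmetric_matrix_iff)
  have "transpose P = P"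
    using assms by (auto simp: positive_semidefinite_def symmetric_matrix_def)
  then show "v \<bullet> (P *v w) = (P *v v) \<bullet> w"
    by (metis dot_lmul_matrix vector_transpose_matrix)
qed

lemma axis_inner_matrix: "axis i 1 \<bullet> (P *v axis j 1) = P $ i $ j" for P :: "real^'n^'m"
  by (simp add: inner_axis' matrix_vector_mul_component inner_axis)

lemma matrix_mult_axis: "(P *v axis j 1) $ i = P $ i $ j" for P :: "real^'n^'m"
  by (simp add: matrix_vector_mul_component inner_axis)

text \<open>If the entry \<open>P $ k $ j\<close> were nonzero, then along \<open>axis j 1 + s *\<^sub>R axis k 1\<close> the quadratic form
of \<open>P\<close> would be a nonconstant affine function of \<open>s\<close>, hence negative somewhere.\<close>

lemma positive_semidefinite_zero_row:
  assumes P: "positive_semidefinite P" and 0: "P $ k $ k = 0"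
  shows "P $ k $ j = 0"
proof (rule ccontr)
  assume nz: "P $ k $ j \<noteq> 0"
  define s where "s = - (P $ j $ j + 1) / (2 * P $ k $ j)"
  let ?v = "axis j 1 + s *\<^sub>R axis k 1"
  have "0 \<le> ?v \<bullet> (P *v ?v)" using positive_semidefiniteD(2)[OF P] .
  also have "\<dots> = P $ j $ j + 2 * s * P $ k $ j"
    using 0 positive_semidefiniteD(1)[OF P, of j k]
    by (simp add: matrix_vector_right_distrib inner_add_left inner_add_right axis_inner_matrix
        matrix_vector_mult_scaleR)
  also have "\<dots> = -1" using nz by (simp add: s_def field_simps)
  finally show False by simp
qed

text \<open>One step of symmetric Gaussian elimination: the quadratic form of the reduced matrix at \<open>v\<close> is the
minimum of the quadratic form of \<open>P\<close> over the line through \<open>v\<close> in direction \<open>axis k 1\<close>.\<close>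

lemma positive_semidefinite_schur_complement:
  assumes P: "positive_semidefinite P" and a: "0 < P $ k $ k"
  shows "positive_semidefinite (P - (1 / P $ k $ k) *\<^sub>R outer (P $ k) (P $ k))"
proof -
  let ?a = "P $ k $ k" and ?w = "P $ k"
  have "0 \<le> v \<bullet> ((P - (1 / ?a) *\<^sub>R outer ?w ?w) *v v)" for v
  proof -
    \<comment> \<open>the minimiser on the line through \<open>v\<close> in direction \<open>axis k 1\<close>\<close>
    let ?v = "v - ((?w \<bullet> v) / ?a) *\<^sub>R axis k 1"
    have wv: "axis k 1 \<bullet> (P *v v) = ?w \<bullet> v"
      by (simp add: inner_axis' matrix_vector_mul_component)
    then have vw: "v \<bullet> (P *v axis k 1) = ?w \<bullet> v"
      using positive_semidefiniteD(3)[OF P, of v "axis k 1"] by (simp add: inner_commute)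
    have "0 \<le> ?v \<bullet> (P *v ?v)" using positive_semidefiniteD(2)[OF P] .
    also have "\<dots> = v \<bullet> (P *v v) - (?w \<bullet> v)\<^sup>2 / ?a"
      using a wv vw
      by (simp add: matrix_vector_mult_diff_distrib inner_diff_left inner_diff_right
          axis_inner_matrix matrix_vector_mult_scaleR field_simps power2_eq_square)
    also have "\<dots> = v \<bullet> ((P - (1 / ?a) *\<^sub>R outer ?w ?w) *v v)"
      by (simp add: matrix_vector_mult_diff_rdistrib scaleR_matrix_vector_assoc[symmetric]
          outer_mult_vector inner_diff_right power2_eq_square inner_commute)
    finally show ?thesis .
  qed
  then show ?thesis
    using positive_semidefiniteD(1)[OF P]
    by (simp add: positive_semidefinite_def symmetric_matrix_iff outer_def mult.commute)
qed

text \<open>The inner product of matrices is the Frobenius product, so this is the positivity of the trace of a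
product of two positive semidefinite matrices.  Eliminating one row of \<open>P\<close> after the other writes
\<open>P\<close> as a sum of matrices \<open>outer w w\<close> with positive weights, and the Frobenius product of
\<open>outer w w\<close> with \<open>Q\<close> is a value of the quadratic form of \<open>Q\<close>.  The induction is on a set \<open>S\<close> that
contains the indices of the nonzero rows.\<close>

lemma positive_semidefinite_inner_nonneg:
  assumes "positive_semidefinite P" and Q: "positive_semidefinite Q"
  shows "0 \<le> P \<bullet> Q"
proof -
  have "0 \<le> P \<bullet> Q"
    if "finite S" "positive_semidefinite P" "\<And>i j. i \<notin> S \<Longrightarrow> P $ i $ j = 0" for S and P
    using that
  proof (induction S arbitrary: P rule: finite_induct)
    case empty
    then show ?case by (simp add: matrix_inner_sums)
  next
    case (insert k S)
    note P = insert.prems(1) and row = insert.prems(2)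
    let ?a = "P $ k $ k" and ?w = "P $ k"
    have "0 \<le> ?a"
      using positive_semidefiniteD(2)[OF P, of "axis k 1"] by (simp add: axis_inner_matrix)
    then consider "?a = 0" | "0 < ?a" by linarith
    then show ?case
    proof cases
      case 1
      show ?thesis
      proof (rule insert.IH[OF P])
        show "P $ i $ j = 0" if "i \<notin> S" for i j
          using that row[of i j] positive_semidefinite_zero_row[OF P 1, of j] by (cases "i = k") auto
      qed
    next
      case 2
      let ?R = "P - (1 / ?a) *\<^sub>R outer ?w ?w"
      have "0 \<le> ?R \<bullet> Q"
      proof (rule insert.IH[OF positive_semidefinite_schur_complement[OF P 2]])
        show "?R $ i $ j = 0" if "i \<notin> S" for i j
          using that 2 row[of i] positive_semidefiniteD(1)[OF P, of k i]
          by (cases "i = k") (auto simp: outer_def)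
      qed
      moreover have "0 \<le> (1 / ?a) * (?w \<bullet> (Q *v ?w))"
        using 2 positive_semidefiniteD(2)[OF Q] by simp
      moreover have "P \<bullet> Q = ?R \<bullet> Q + (1 / ?a) * (?w \<bullet> (Q *v ?w))"
        by (simp add: inner_diff_left inner_commute[of "outer ?w ?w"] inner_outer)
      ultimately show ?thesis by simp
    qed
  qed
  from this[of UNIV P] assms(1) show ?thesis by simp
qed

text \<open>With \<open>J\<close> the Jacobian of an inner function and \<open>H\<close> the Hessian of the outer function, this moves the
coefficients \<open>C\<close> of an elliptic operator from the domain to the codomain of the inner function: on
the right, \<open>J ** C ** transpose J\<close> is the Gram matrix of the gradients of the components.\<close>

lemma inner_congruence: "C \<bullet> (transpose J ** H ** J) = (J ** C ** transpose J) \<bullet> H"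
  for J :: "real^'n^'m"
  by (simp add: inner_matrix_mult_right[of C "transpose J ** H" J] matrix_mul_assoc
      inner_matrix_mult_left[of "C ** transpose J" "transpose J" H])

lemma congruence_quadratic: "v \<bullet> ((transpose J ** H ** J) *v v) = (J *v v) \<bullet> (H *v (J *v v))"
  for J :: "real^'n^'m"
  by (simp add: matrix_vector_mul_assoc[symmetric] dot_lmul_matrix inner_commute[of v]
      inner_commute[of "J *v v"])

lemma positive_semidefinite_congruence:
  fixes J :: "real^'n^'m"
  assumes C: "positive_semidefinite C"
  shows "positive_semidefinite (J ** C ** transpose J)"
proof -
  have "transpose C = C" using C by (simp add: positive_semidefinite_def symmetric_matrix_def)
  then show ?thesis
    using congruence_quadratic[of _ "transpose J" C] positive_semidefiniteD(2)[OF C]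
    by (simp add: positive_semidefinite_def symmetric_matrix_def matrix_transpose_mul matrix_mul_assoc)
qed

lemma inner_diag_matrix: "P \<bullet> diag_matrix d = (\<Sum>k\<in>UNIV. d $ k * P $ k $ k)"
  by (simp add: matrix_inner_sums diag_matrix_def if_distrib mult.commute cong: if_cong)

lemma congruence_diagonal: "(J ** C ** transpose J) $ k $ k = J $ k \<bullet> (C *v J $ k)"
  for J :: "real^'n^'m"
proof -
  have "(J ** C ** transpose J) $ k $ k = axis k 1 \<bullet> ((J ** C ** transpose J) *v axis k 1)"
    by (simp add: axis_inner_matrix)
  also have "\<dots> = (transpose J *v axis k 1) \<bullet> (C *v (transpose J *v axis k 1))"
    using congruence_quadratic[of "axis k 1" "transpose J" C] by simp
  also have "transpose J *v axis k 1 = J $ k"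
    by (simp add: vec_eq_iff matrix_mult_axis transpose_def)
  finally show ?thesis .
qed

text \<open>A matrix bound on \<open>H\<close> may be tested against the Gram matrix of the rows of \<open>J\<close>, which is positive
semidefinite; a diagonal bound only sees the diagonal entries of the Gram matrix.\<close>

lemma inner_congruence_le:
  fixes J :: "real^'n^'m"
  assumes C: "positive_semidefinite C" and H: "H \<le>\<^sub>p\<^sub>s\<^sub>d lam *\<^sub>R diag_matrix d"
  shows "C \<bullet> (transpose J ** H ** J) \<le> lam * (\<Sum>k\<in>UNIV. d $ k * (J $ k \<bullet> (C *v J $ k)))"
proof -
  have "0 \<le> (J ** C ** transpose J) \<bullet> (lam *\<^sub>R diag_matrix d - H)"
    using positive_semidefinite_inner_nonneg[OF positive_semidefinite_congruence[OF C]] H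
    by (simp add: psd_le_def)
  then show ?thesis
    by (simp add: inner_diff_right inner_congruence inner_diag_matrix congruence_diagonal)
qed

text \<open>Positivity of the inverse is seen by writing vectors as \<open>A *v w\<close>; the second claim is
\<open>trace (matrix_inv A ** A) = n\<close>, the origin of the dimension in the exponent of \<open>t\<close>.\<close>

lemma positive_definite_inverse:
  fixes A :: "real^'n^'n"
  assumes A: "positive_definite A"
  shows "positive_semidefinite (matrix_inv A)" and "matrix_inv A \<bullet> A = real CARD('n)"
proof -
  have sA: "transpose A = A" using A by (simp add: positive_definite_def symmetric_matrix_def)
  have "v = 0" if "A *v v = 0" for v
    using A that unfolding positive_definite_def by (metis inner_zero_right less_irrefl)
  then obtain D where "D ** A = mat 1"
    using matrix_left_invertible_ker[of A] by auto
  then have inv: "invertible A" using invertible_left_inverse by blast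
  have 1: "A ** matrix_inv A = mat 1" and 2: "matrix_inv A ** A = mat 1"
    using inv someI_ex[of "\<lambda>A'. A ** A' = mat 1 \<and> A' ** A = mat 1"]
    unfolding matrix_inv_def invertible_def by auto
  let ?C = "matrix_inv A"
  have sC: "transpose ?C = ?C"
  proof -
    have "transpose ?C ** A = mat 1"
      using arg_cong[OF 1, of transpose] by (simp add: matrix_transpose_mul sA transpose_mat)
    then have "transpose ?C ** A ** ?C = ?C" by simp
    then show ?thesis by (simp add: matrix_mul_assoc[symmetric] 1)
  qed
  have "0 \<le> v \<bullet> (?C *v v)" for v
  proof -
    have "v = A *v (?C *v v)" by (simp add: matrix_vector_mul_assoc 1)
    then have "v \<bullet> (?C *v v) = (?C *v v) \<bullet> (A *v (?C *v v))" by (metis inner_commute)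
    also have "\<dots> \<ge> 0"
      using A unfolding positive_definite_def by (cases "?C *v v = 0") (auto simp: less_imp_le)
    finally show ?thesis .
  qed
  with sC show "positive_semidefinite ?C"
    by (simp add: positive_semidefinite_def symmetric_matrix_def)
  have "?C \<bullet> A = ?C \<bullet> (mat 1 ** A)" by simp
  also have "\<dots> = (mat 1 :: real^'n^'n) \<bullet> mat 1"
    by (simp only: inner_matrix_mult_right sA 2)
  also have "\<dots> = real CARD('n)"
    by (simp add: matrix_inner_sums mat_def if_distrib cong: if_cong)
  finally show "?C \<bullet> A = real CARD('n)" .
qed

lemma symmetric_matrix_congruence:
  fixes J :: "real^'n^'m"
  assumes "symmetric_matrix H"
  shows "symmetric_matrix (transpose J ** H ** J)"
  using assms by (simp add: symmetric_matrix_def matrix_transpose_mul matrix_mul_assoc)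

lemma diag_matrix_quadratic: "v \<bullet> (diag_matrix d *v v) = (\<Sum>k\<in>UNIV. d $ k * (v $ k)\<^sup>2)"
  by (simp add: inner_outer[symmetric] inner_commute[of "diag_matrix d"] inner_diag_matrix)
     (simp add: outer_def power2_eq_square inner_commute inner_diag_matrix)

lemma psd_leD: "P \<le>\<^sub>p\<^sub>s\<^sub>d Q \<Longrightarrow> v \<bullet> (P *v v) \<le> v \<bullet> (Q *v v)"
  by (simp add: psd_le_def positive_semidefinite_def matrix_vector_mult_diff_rdistrib inner_diff_right)

text \<open>Matrices related by the semidefinite order have the same antisymmetric part, which is zero for a
diagonal matrix.  This replaces Schwarz's theorem for \<open>B\<close>, whose second derivatives
need not be continuous.\<close>

lemma psd_le_diag_matrix_imp_symmetric:
  assumes "H \<le>\<^sub>p\<^sub>s\<^sub>d lam *\<^sub>R diag_matrix d"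
  shows "symmetric_matrix H"
  unfolding symmetric_matrix_iff
proof (intro allI)
  fix i j
  show "H $ i $ j = H $ j $ i"
    using positive_semidefiniteD(1)[OF assms[unfolded psd_le_def], of i j]
    by (cases "i = j") (auto simp: diag_matrix_def)
qed

section \<open>Gradients and Hessians\<close>

text \<open>The second derivative in coordinates, with the index order of \<open>hessian\<close>: the first index of \<open>H y\<close> is
the direction in which the gradient field is differentiated, so that \<open>H y\<close> acts on directions from
the right.  Symmetry is not built in, since continuity of the second derivatives is not.\<close>

definition has_grad_hess ::
  "(real^'n \<Rightarrow> real) \<Rightarrow> (real^'n \<Rightarrow> real^'n) \<Rightarrow> (real^'n \<Rightarrow> real^'n^'n) \<Rightarrow> (real^'n) set \<Rightarrow> bool"
  where "has_grad_hess f G H S \<longleftrightarrow>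
    (\<forall>y\<in>S. (f has_derivative (\<lambda>h. G y \<bullet> h)) (at y) \<and> (G has_derivative (\<lambda>h. h v* H y)) (at y))"

lemma has_derivative_imp_partial_derivative:
  assumes "(f has_derivative D) (at x)"
  shows "partial_derivative i f x = D (axis i 1)"
proof -
  have "((\<lambda>s. x + s *\<^sub>R axis i 1) has_derivative (\<lambda>s. s *\<^sub>R axis i 1)) (at 0)"
    by (auto intro!: derivative_eq_intros)
  then have "((\<lambda>s. f (x + s *\<^sub>R axis i 1)) has_derivative (\<lambda>s. D (s *\<^sub>R axis i 1))) (at 0)"
    using has_derivative_compose[of "\<lambda>s. x + s *\<^sub>R axis i 1" _ 0 UNIV f D] assms by simp
  moreover have "D (s *\<^sub>R axis i 1) = D (axis i 1) * s" for s
    using linear_scale[OF has_derivative_linear[OF assms]] by simp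
  ultimately have "((\<lambda>s. f (x + s *\<^sub>R axis i 1)) has_real_derivative D (axis i 1)) (at 0)"
    by (simp add: has_field_derivative_def)
  then show ?thesis unfolding partial_derivative_def by (rule DERIV_imp_deriv)
qed

lemma vec_eq_sum_axis: "v = (\<Sum>i\<in>UNIV. v $ i *\<^sub>R axis i 1)" for v :: "real^'n"
  using basis_expansion[of v] by (simp add: scalar_mult_eq_scaleR)

lemma vector_matrix_mult_axis: "(axis i 1 v* H) $ j = H $ i $ j" for H :: "real^'n^'m"
  by (simp add: vector_matrix_mult_def axis_def if_distrib[of "\<lambda>x. x * _"] if_distrib[of "\<lambda>x. _ * x"] cong: if_cong)

lemma has_derivative_vec_nth:
  assumes "(F has_derivative D) (at x)"
  shows "((\<lambda>y. F y $ i) has_derivative (\<lambda>h. D h $ i)) (at x)"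
  by (rule bounded_linear.has_derivative[OF bounded_linear_vec_nth assms])

lemma twice_differentiable_on_imp_has_grad_hess:
  assumes "twice_differentiable_on f S"
  shows "has_grad_hess f (gradient f) (hessian f) S"
  unfolding has_grad_hess_def
proof (intro ballI conjI)
  fix y assume y: "y \<in> S"
  then obtain D E where D: "(f has_derivative D) (at y)" and E: "(gradient f has_derivative E) (at y)"
    using assms unfolding twice_differentiable_on_def differentiable_def by blast
  have "D h = gradient f y \<bullet> h" for h
  proof -
    have "D h = D (\<Sum>i\<in>UNIV. h $ i *\<^sub>R axis i 1)" by (simp flip: vec_eq_sum_axis)
    also have "\<dots> = (\<Sum>i\<in>UNIV. h $ i * D (axis i 1))"
      using has_derivative_linear[OF D] by (simp add: linear_sum linear_scale)
    finally show ?thesis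
      by (simp add: gradient_def inner_vec_def has_derivative_imp_partial_derivative[OF D] mult.commute)
  qed
  then have "D = (\<lambda>h. gradient f y \<bullet> h)" by (rule ext)
  with D show "(f has_derivative (\<lambda>h. gradient f y \<bullet> h)) (at y)" by simp
  have "E h = h v* hessian f y" for h
  proof -
    have *: "hessian f y $ i $ j = E (axis i 1) $ j" for i j
      using has_derivative_imp_partial_derivative[OF has_derivative_vec_nth[OF E, of j], of i]
      by (simp add: hessian_def gradient_def)
    have "E h = E (\<Sum>i\<in>UNIV. h $ i *\<^sub>R axis i 1)" by (simp flip: vec_eq_sum_axis)
    also have "\<dots> = (\<Sum>i\<in>UNIV. h $ i *\<^sub>R E (axis i 1))"
      using has_derivative_linear[OF E] by (simp add: linear_sum linear_scale)
    finally show ?thesis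
      by (simp add: vec_eq_iff vector_matrix_mult_def * mult.commute)
  qed
  then have "E = (\<lambda>h. h v* hessian f y)" by (rule ext)
  with E show "(gradient f has_derivative (\<lambda>h. h v* hessian f y)) (at y)" by simp
qed

lemma has_grad_hess_UNIV_unique:
  assumes "has_grad_hess f G H UNIV"
  shows "gradient f = G" "hessian f = H"
proof -
  have D: "(f has_derivative (\<lambda>h. G y \<bullet> h)) (at y)" and E: "(G has_derivative (\<lambda>h. h v* H y)) (at y)" for y
    using assms by (auto simp: has_grad_hess_def)
  have p: "partial_derivative i f = (\<lambda>y. G y $ i)" for i
    using has_derivative_imp_partial_derivative[OF D] by (simp add: fun_eq_iff inner_axis)
  then show "gradient f = G" by (simp add: fun_eq_iff gradient_def)
  show "hessian f = H"
    using has_derivative_imp_partial_derivative[OF has_derivative_vec_nth[OF E]]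
    by (simp add: fun_eq_iff vec_eq_iff hessian_def p vector_matrix_mult_axis)
qed

text \<open>A divergence form operator with constant coefficients is a Frobenius product with the Hessian, so
matrix inequalities for Hessians become inequalities for \<open>divergence\<close>.\<close>

lemma divergence_matrix_gradient:
  assumes "has_grad_hess f G H UNIV"
  shows "divergence (\<lambda>y. C *v gradient f y) x = C \<bullet> H x"
proof -
  have "(G has_derivative (\<lambda>h. h v* H x)) (at x)" using assms by (auto simp: has_grad_hess_def)
  then have D: "((\<lambda>y. C *v G y) has_derivative (\<lambda>h. C *v (h v* H x))) (at x)"
    by (rule bounded_linear.has_derivative[OF matrix_vector_mul_bounded_linear])
  show ?thesis
    unfolding divergence_def has_grad_hess_UNIV_unique[OF assms]
      has_derivative_imp_partial_derivative[OF has_derivative_vec_nth[OF D]]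
    by (simp add: inner_vec_def matrix_vector_mul_component vector_matrix_mult_axis)
qed

lemma has_derivative_vec_lambda:
  assumes "\<And>k. (U k has_derivative D k) (at x within T)"
  shows "((\<lambda>y. (\<chi> k. U k y) :: real^_) has_derivative (\<lambda>h. \<chi> k. D k h)) (at x within T)"
  using assms
  by (subst has_derivative_componentwise_within) (auto simp: Basis_vec_def inner_axis)

lemma vector_matrix_eq_sum_rows: "v v* J = (\<Sum>k\<in>UNIV. v $ k *\<^sub>R J $ k)" for J :: "real^'n^'m"
  by (simp add: vec_eq_iff vector_matrix_mult_def mult.commute)

text \<open>In the second order chain rule, \<open>\<chi> k. g k y\<close> is the Jacobian of the inner function; the congruence
comes from the Hessian of the outer function, and the sum from the Hessians of the components of the
inner one.\<close>

lemma has_grad_hess_compose: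
  fixes U :: "'m::finite \<Rightarrow> real^'n \<Rightarrow> real"
  assumes f: "has_grad_hess f G H S" and U: "\<And>k. has_grad_hess (U k) (g k) (h k) T"
    and S: "\<And>y. y \<in> T \<Longrightarrow> (\<chi> k. U k y) \<in> S"
  shows "has_grad_hess (\<lambda>y. f (\<chi> k. U k y))
    (\<lambda>y. G (\<chi> k. U k y) v* (\<chi> k. g k y))
    (\<lambda>y. transpose (\<chi> k. g k y) ** H (\<chi> k. U k y) ** (\<chi> k. g k y)
         + (\<Sum>k\<in>UNIV. G (\<chi> k. U k y) $ k *\<^sub>R h k y)) T"
  unfolding has_grad_hess_def
proof (intro ballI conjI)
  fix y assume y: "y \<in> T"
  let ?U = "\<lambda>y. \<chi> k. U k y" and ?J = "\<chi> k. g k y"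
  have "((\<lambda>y. ?U y) has_derivative (\<lambda>v. \<chi> k. g k y \<bullet> v)) (at y)"
    by (rule has_derivative_vec_lambda) (use U y in \<open>auto simp: has_grad_hess_def\<close>)
  then have dU: "(?U has_derivative (\<lambda>v. ?J *v v)) (at y)"
    by (simp add: matrix_vector_mult_def inner_vec_def)
  have df: "(f has_derivative (\<lambda>v. G (?U y) \<bullet> v)) (at (?U y))"
    and dG: "(G has_derivative (\<lambda>v. v v* H (?U y))) (at (?U y))"
    using f S[OF y] by (auto simp: has_grad_hess_def)
  show "((\<lambda>y. f (?U y)) has_derivative (\<lambda>v. (G (?U y) v* ?J) \<bullet> v)) (at y)"
    using has_derivative_compose[OF dU df] by (simp add: dot_lmul_matrix)
  have dGk: "((\<lambda>y. G (?U y) $ k) has_derivative (\<lambda>v. ((?J *v v) v* H (?U y)) $ k)) (at y)" for k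
    by (rule has_derivative_vec_nth, rule has_derivative_compose[OF dU dG])
  have dg: "(g k has_derivative (\<lambda>v. v v* h k y)) (at y)" for k
    using U y by (auto simp: has_grad_hess_def)
  have "((\<lambda>y. \<Sum>k\<in>UNIV. G (?U y) $ k *\<^sub>R g k y) has_derivative
      (\<lambda>v. \<Sum>k\<in>UNIV. G (?U y) $ k *\<^sub>R (v v* h k y) + (((?J *v v) v* H (?U y)) $ k) *\<^sub>R g k y)) (at y)"
    by (intro has_derivative_sum has_derivative_scaleR dGk dg)
  moreover have "(\<Sum>k\<in>UNIV. G (?U y) $ k *\<^sub>R (v v* h k y) + (((?J *v v) v* H (?U y)) $ k) *\<^sub>R g k y)
      = v v* (transpose ?J ** H (?U y) ** ?J + (\<Sum>k\<in>UNIV. G (?U y) $ k *\<^sub>R h k y))" for v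
  proof -
    have "v v* (\<Sum>k\<in>UNIV. G (?U y) $ k *\<^sub>R h k y) = (\<Sum>k\<in>UNIV. G (?U y) $ k *\<^sub>R (v v* h k y))"
      by (simp add: vec_eq_iff vector_matrix_mult_def sum_distrib_left sum_distrib_right mult_ac)
         (intro allI sum.swap)
    moreover have "v v* (transpose ?J ** H (?U y) ** ?J) = ((?J *v v) v* H (?U y)) v* ?J"
      by (simp add: vector_matrix_mul_assoc[symmetric])
    moreover have "v v* (P + Q) = v v* P + v v* Q" for P Q :: "real^'n^'n"
      by (simp add: vec_eq_iff vector_matrix_mult_def distrib_left sum.distrib)
    ultimately show ?thesis
      by (simp add: sum.distrib vector_matrix_eq_sum_rows[of _ ?J] add.commute)
  qed
  ultimately show "((\<lambda>y. G (?U y) v* (\<chi> k. g k y)) has_derivative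
      (\<lambda>v. v v* (transpose ?J ** H (?U y) ** ?J + (\<Sum>k\<in>UNIV. G (?U y) $ k *\<^sub>R h k y)))) (at y)"
    by (simp add: vector_matrix_eq_sum_rows[of _ "\<chi> k. g k _"])
qed

lemma has_grad_hess_cmult:
  assumes "has_grad_hess f G H S"
  shows "has_grad_hess (\<lambda>y. c * f y) (\<lambda>y. c *\<^sub>R G y) (\<lambda>y. c *\<^sub>R H y) S"
  unfolding has_grad_hess_def
proof (intro ballI conjI)
  fix y assume "y \<in> S"
  then have D: "(f has_derivative (\<lambda>h. G y \<bullet> h)) (at y)" and E: "(G has_derivative (\<lambda>h. h v* H y)) (at y)"
    using assms by (auto simp: has_grad_hess_def)
  show "((\<lambda>y. c * f y) has_derivative (\<lambda>h. (c *\<^sub>R G y) \<bullet> h)) (at y)"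
    using has_derivative_mult_right[OF D, of c] by simp
  show "((\<lambda>y. c *\<^sub>R G y) has_derivative (\<lambda>h. h v* (c *\<^sub>R H y))) (at y)"
    using has_derivative_scaleR_right[OF E, of c]
    by (simp add: vector_scaleR_matrix_ac)
qed

lemma has_grad_hess_ln:
  assumes f: "has_grad_hess f G H S" and pos: "\<And>y. y \<in> S \<Longrightarrow> 0 < f y"
  shows "has_grad_hess (\<lambda>y. ln (f y)) (\<lambda>y. (1 / f y) *\<^sub>R G y)
    (\<lambda>y. (1 / f y) *\<^sub>R H y - (1 / (f y)\<^sup>2) *\<^sub>R outer (G y) (G y)) S"
  unfolding has_grad_hess_def
proof (intro ballI conjI)
  fix y assume y: "y \<in> S"
  then have D: "(f has_derivative (\<lambda>h. G y \<bullet> h)) (at y)" and E: "(G has_derivative (\<lambda>h. h v* H y)) (at y)"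
    using f by (auto simp: has_grad_hess_def)
  show "((\<lambda>y. ln (f y)) has_derivative (\<lambda>h. ((1 / f y) *\<^sub>R G y) \<bullet> h)) (at y)"
    using pos[OF y] by (auto intro!: derivative_eq_intros D simp: field_simps)
  have "((\<lambda>y. (1 / f y) *\<^sub>R G y) has_derivative
      (\<lambda>h. (1 / f y) *\<^sub>R (h v* H y) - ((G y \<bullet> h) / (f y)\<^sup>2) *\<^sub>R G y)) (at y)"
    using pos[OF y] by (auto intro!: derivative_eq_intros D E simp: field_simps power2_eq_square)
  moreover have "(1 / f y) *\<^sub>R (h v* H y) - ((G y \<bullet> h) / (f y)\<^sup>2) *\<^sub>R G y
     = h v* ((1 / f y) *\<^sub>R H y - (1 / (f y)\<^sup>2) *\<^sub>R outer (G y) (G y))" for h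
    by (simp add: vec_eq_iff vector_matrix_mult_def outer_def inner_vec_def algebra_simps
        sum_subtractf sum_distrib_left sum_distrib_right sum_divide_distrib)
  ultimately show "((\<lambda>y. (1 / f y) *\<^sub>R G y) has_derivative
      (\<lambda>h. h v* ((1 / f y) *\<^sub>R H y - (1 / (f y)\<^sup>2) *\<^sub>R outer (G y) (G y)))) (at y)"
    by simp
qed

lemma has_grad_hess_along_curve:
  assumes f: "has_grad_hess f G H S" and S: "c s \<in> S"
    and c: "(c has_vector_derivative c' s) (at s)"
    and c': "(c' has_vector_derivative c'') (at s)"
  shows "((\<lambda>s. f (c s)) has_real_derivative G (c s) \<bullet> c' s) (at s)"
    and "((\<lambda>s. G (c s) \<bullet> c' s) has_real_derivative
           c' s \<bullet> (H (c s) *v c' s) + G (c s) \<bullet> c'') (at s)"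
proof -
  have D: "(f has_derivative (\<lambda>h. G (c s) \<bullet> h)) (at (c s))"
    and E: "(G has_derivative (\<lambda>h. h v* H (c s))) (at (c s))"
    using f S by (auto simp: has_grad_hess_def)
  note c0 = c[unfolded has_vector_derivative_def] and c1 = c'[unfolded has_vector_derivative_def]
  show "((\<lambda>s. f (c s)) has_real_derivative G (c s) \<bullet> c' s) (at s)"
    using has_derivative_compose[OF c0 D]
    by (simp add: has_field_derivative_def mult.commute[of _ "G (c s) \<bullet> c' s"])
  have "((\<lambda>s. G (c s) \<bullet> c' s) has_derivative
      (\<lambda>r. G (c s) \<bullet> (r *\<^sub>R c'') + ((r *\<^sub>R c' s) v* H (c s)) \<bullet> c' s)) (at s)"
    using has_derivative_inner[OF has_derivative_compose[OF c0 E] c1] .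
  moreover have "(\<lambda>r. G (c s) \<bullet> (r *\<^sub>R c'') + ((r *\<^sub>R c' s) v* H (c s)) \<bullet> c' s)
      = (*) (c' s \<bullet> (H (c s) *v c' s) + G (c s) \<bullet> c'')"
    by (simp add: fun_eq_iff dot_lmul_matrix algebra_simps)
  ultimately show "((\<lambda>s. G (c s) \<bullet> c' s) has_real_derivative
           c' s \<bullet> (H (c s) *v c' s) + G (c s) \<bullet> c'') (at s)"
    by (simp add: has_field_derivative_def)
qed

lemma has_real_derivative_powr_times_compose:
  fixes U :: "'m::finite \<Rightarrow> real \<Rightarrow> real"
  assumes B: "has_grad_hess B G H S" and S: "(\<chi> j. U j t) \<in> S" and t: "0 < t"
    and U: "\<And>j. (U j has_real_derivative D j) (at t)"
  shows "((\<lambda>s. s powr a * B (\<chi> j. U j s)) has_real_derivative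
     t powr a * (a / t * B (\<chi> j. U j t) + (\<Sum>j\<in>UNIV. G (\<chi> j. U j t) $ j * D j))) (at t)"
proof -
  have "((\<lambda>s. \<chi> j. U j s) has_derivative (\<lambda>h. \<chi> j. D j * h)) (at t)"
    by (rule has_derivative_vec_lambda) (use U in \<open>auto simp: has_field_derivative_def\<close>)
  moreover have "(B has_derivative (\<lambda>h. G (\<chi> j. U j t) \<bullet> h)) (at (\<chi> j. U j t))"
    using B S by (auto simp: has_grad_hess_def)
  ultimately have "((\<lambda>s. B (\<chi> j. U j s)) has_derivative
      (\<lambda>h. G (\<chi> j. U j t) \<bullet> (\<chi> j. D j * h))) (at t)"
    by (rule has_derivative_compose)
  moreover have "(\<lambda>h. G (\<chi> j. U j t) \<bullet> (\<chi> j. D j * h))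
      = (*) (\<Sum>j\<in>UNIV. G (\<chi> j. U j t) $ j * D j)"
    by (simp add: fun_eq_iff inner_vec_def sum_distrib_left mult_ac)
  ultimately have dB: "((\<lambda>s. B (\<chi> j. U j s)) has_real_derivative
      (\<Sum>j\<in>UNIV. G (\<chi> j. U j t) $ j * D j)) (at t)"
    by (simp add: has_field_derivative_def)
  have "t powr (a - 1) = t powr a / t" using t by (simp add: powr_diff)
  then show ?thesis
    using t by (auto intro!: derivative_eq_intros dB simp: algebra_simps)
qed

section \<open>Consequences of the Hessian bound and of logarithmic convexity\<close>

text \<open>Adding the tangent inequalities at \<open>0\<close> and at \<open>s\<close> shows that the difference quotients of \<open>f'\<close> at \<open>0\<close>
are nonnegative.\<close>

lemma convex_second_derivative_nonneg:
  fixes f :: "real \<Rightarrow> real"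
  assumes cvx: "convex_on UNIV f" and f': "\<And>s. (f has_real_derivative f' s) (at s)"
    and f'': "(f' has_real_derivative D) (at 0)"
  shows "0 \<le> D"
proof -
  have mono: "0 \<le> f' s * s - f' 0 * s" for s
    using convex_on_imp_above_tangent[OF cvx, of 0 s "f' 0"]
      convex_on_imp_above_tangent[OF cvx, of s 0 "f' s"] f' by (simp add: algebra_simps)
  have "((\<lambda>s. (f' s - f' 0) / s) \<longlongrightarrow> D) (at 0)"
    using f'' by (simp add: has_field_derivative_iff)
  moreover have "0 \<le> (f' s - f' 0) / s" for s
  proof (cases "s = 0")
    case False
    have "(f' s - f' 0) / s = (f' s * s - f' 0 * s) / s\<^sup>2"
      using False by (simp add: field_simps power2_eq_square)
    then show ?thesis using mono[of s] by simp
  qed simp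
  ultimately show ?thesis by (auto intro: tendsto_lowerbound)
qed

text \<open>Along the ray \<open>s \<mapsto> s *\<^sub>R x\<close> the function \<open>g s = B (s *\<^sub>R x)\<close> satisfies \<open>s * g'' s \<le> lam * g' s\<close>, which
says that \<open>F s = s * g' s - (1 + lam) * g s\<close> is nonincreasing.  If \<open>F 1\<close> were positive, then
\<open>s * g' s \<ge> F s \<ge> F 1\<close> on the unit interval, so \<open>g\<close> would tend to minus infinity logarithmically as
\<open>s\<close> tends to \<open>0\<close>, against its positivity.\<close>

lemma diagonal_hessian_bound_imp_euler:
  fixes B :: "real^'m \<Rightarrow> real"
  assumes B: "has_grad_hess B G H positive_orthant"
    and pos: "\<And>x. x \<in> positive_orthant \<Longrightarrow> 0 < B x"
    and hess: "\<And>x. x \<in> positive_orthant \<Longrightarrow> H x \<le>\<^sub>p\<^sub>s\<^sub>d lam *\<^sub>R diag_matrix (\<chi> j. G x $ j / x $ j)"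
    and lam: "0 \<le> lam" and x: "x \<in> positive_orthant"
  shows "G x \<bullet> x \<le> (1 + lam) * B x"
proof (rule ccontr)
  define F where "F s = s * (G (s *\<^sub>R x) \<bullet> x) - (1 + lam) * B (s *\<^sub>R x)" for s
  assume "\<not> ?thesis"
  then have F1: "0 < F 1" by (simp add: F_def)
  have ray: "s *\<^sub>R x \<in> positive_orthant" if "0 < s" for s
    using x that by (simp add: positive_orthant_def)
  have line: "((\<lambda>s. s *\<^sub>R x) has_vector_derivative x) (at s)"
      "((\<lambda>s. x) has_vector_derivative 0) (at s)" for s :: real
    by (auto intro!: derivative_eq_intros)
  have dB: "((\<lambda>s. B (s *\<^sub>R x)) has_real_derivative G (s *\<^sub>R x) \<bullet> x) (at s)" if "0 < s" for s
    using has_grad_hess_along_curve(1)[OF B ray[OF that] line] .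
  have dG: "((\<lambda>s. G (s *\<^sub>R x) \<bullet> x) has_real_derivative x \<bullet> (H (s *\<^sub>R x) *v x)) (at s)"
    if "0 < s" for s
    using has_grad_hess_along_curve(2)[OF B ray[OF that] line] by simp
  have quad: "s * (x \<bullet> (H (s *\<^sub>R x) *v x)) \<le> lam * (G (s *\<^sub>R x) \<bullet> x)" if "0 < s" for s
  proof -
    have "x \<bullet> (H (s *\<^sub>R x) *v x)
        \<le> lam * (\<Sum>k\<in>UNIV. G (s *\<^sub>R x) $ k / (s * x $ k) * (x $ k)\<^sup>2)"
      using psd_leD[OF hess[OF ray[OF that]], of x]
      by (simp add: scaleR_matrix_vector_assoc[symmetric] diag_matrix_quadratic)
    also have "(\<Sum>k\<in>UNIV. G (s *\<^sub>R x) $ k / (s * x $ k) * (x $ k)\<^sup>2) = (G (s *\<^sub>R x) \<bullet> x) / s"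
      unfolding inner_vec_def sum_divide_distrib
    proof (rule sum.cong[OF refl])
      fix k show "G (s *\<^sub>R x) $ k / (s * x $ k) * (x $ k)\<^sup>2 = G (s *\<^sub>R x) $ k \<bullet> x $ k / s"
        using x that by (auto simp: positive_orthant_def power2_eq_square)
    qed
    finally show ?thesis using that by (simp add: field_simps)
  qed
  have F_ge: "F 1 \<le> F s" if "0 < s" "s \<le> 1" for s
  proof (rule DERIV_nonpos_imp_nonincreasing[OF \<open>s \<le> 1\<close>])
    fix r assume "s \<le> r" "r \<le> 1"
    with that have r: "0 < r" by simp
    have "(F has_real_derivative
        r * (x \<bullet> (H (r *\<^sub>R x) *v x)) + G (r *\<^sub>R x) \<bullet> x - (1 + lam) * (G (r *\<^sub>R x) \<bullet> x)) (at r)"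
      unfolding F_def
      by (rule derivative_eq_intros refl dB[OF r] dG[OF r])+ simp
    then show "\<exists>y. (F has_real_derivative y) (at r) \<and> y \<le> 0"
      using quad[OF r] by (intro exI conjI) (auto simp: algebra_simps)
  qed
  \<comment> \<open>the point where the bound \<open>B (s *\<^sub>R x) \<le> B x + F 1 * ln s\<close> reaches \<open>0\<close>\<close>
  define s0 where "s0 = exp (- B x / F 1)"
  have s0: "0 < s0" "s0 \<le> 1" and ln_s0: "F 1 * ln s0 = - B x"
    using F1 pos[OF x] by (auto simp: s0_def)
  have "B (s0 *\<^sub>R x) - F 1 * ln s0 \<le> B (1 *\<^sub>R x) - F 1 * ln 1"
  proof (rule DERIV_nonneg_imp_nondecreasing[OF \<open>s0 \<le> 1\<close>])
    fix r assume "s0 \<le> r" "r \<le> 1"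
    with s0 have r: "0 < r" by simp
    have "((\<lambda>s. B (s *\<^sub>R x) - F 1 * ln s) has_real_derivative G (r *\<^sub>R x) \<bullet> x - F 1 * (1 / r)) (at r)"
      using r by (auto intro!: derivative_eq_intros dB)
    moreover have "F 1 \<le> r * (G (r *\<^sub>R x) \<bullet> x)"
    proof -
      have "0 \<le> (1 + lam) * B (r *\<^sub>R x)" using lam pos[OF ray[OF r]] by simp
      then show ?thesis using F_ge[OF r \<open>r \<le> 1\<close>] unfolding F_def[of r] by linarith
    qed
    ultimately show "\<exists>y. ((\<lambda>s. B (s *\<^sub>R x) - F 1 * ln s) has_real_derivative y) (at r) \<and> 0 \<le> y"
      using r by (intro exI conjI) (auto simp: field_simps)
  qed
  then have "B (s0 *\<^sub>R x) \<le> 0" using ln_s0 by simp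
  with pos[OF ray[OF s0(1)]] show False by simp
qed

text \<open>Convexity in logarithmic coordinates is applied along one line, whose image in the orthant is the
curve \<open>c\<close> through \<open>x\<close> with velocity \<open>p\<close>.  The acceleration of \<open>c\<close> produces the diagonal sum.
The inequality is the nonnegativity of the second derivative of \<open>ln (B (c s))\<close> at \<open>s = 0\<close>,
multiplied by \<open>(B x)\<^sup>2\<close>.\<close>

lemma log_convex_second_order:
  fixes B :: "real^'m \<Rightarrow> real"
  assumes B: "has_grad_hess B G H positive_orthant"
    and pos: "\<And>x. x \<in> positive_orthant \<Longrightarrow> 0 < B x"
    and cvx: "convex_on UNIV (\<lambda>x. ln (B (\<chi> j. exp (x $ j))))"
    and x: "x \<in> positive_orthant"
  shows "(G x \<bullet> p)\<^sup>2 \<le> B x * (p \<bullet> (H x *v p) + (\<Sum>k\<in>UNIV. G x $ k * (p $ k)\<^sup>2 / x $ k))"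
proof -
  define a where "a = (\<chi> k. ln (x $ k))"
  define b where "b = (\<chi> k. p $ k / x $ k)"
  define c where "c s = (\<chi> k. exp (a $ k + s * b $ k))" for s
  define c' where "c' s = (\<chi> k. b $ k * exp (a $ k + s * b $ k))" for s
  define c'' where "c'' s = (\<chi> k. (b $ k)\<^sup>2 * exp (a $ k + s * b $ k))" for s
  have xk: "0 < x $ k" for k using x by (simp add: positive_orthant_def)
  have exp_a: "exp (a $ k) = x $ k" for k using xk by (simp add: a_def)
  have c0: "c 0 = x" "c' 0 = p" "c'' 0 = (\<chi> k. (p $ k)\<^sup>2 / x $ k)"
    using xk by (auto simp: c_def c'_def c''_def exp_a b_def vec_eq_iff power2_eq_square less_imp_neq[symmetric])
  have cS: "c s \<in> positive_orthant" for s by (simp add: c_def positive_orthant_def)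
  have dc: "(c has_vector_derivative c' s) (at s)" for s
  proof -
    have "(c has_derivative (\<lambda>r. \<chi> k. r * (b $ k * exp (a $ k + s * b $ k)))) (at s)"
      unfolding c_def by (rule has_derivative_vec_lambda) (auto intro!: derivative_eq_intros)
    moreover have "(\<chi> k. r * (b $ k * exp (a $ k + s * b $ k))) = r *\<^sub>R c' s" for r
      by (simp add: c'_def vec_eq_iff)
    ultimately show ?thesis by (simp add: has_vector_derivative_def)
  qed
  have dc': "(c' has_vector_derivative c'' s) (at s)" for s
  proof -
    have "(c' has_derivative (\<lambda>r. \<chi> k. r * ((b $ k)\<^sup>2 * exp (a $ k + s * b $ k)))) (at s)"
      unfolding c'_def
      by (rule has_derivative_vec_lambda) (auto intro!: derivative_eq_intros simp: power2_eq_square)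
    moreover have "(\<chi> k. r * ((b $ k)\<^sup>2 * exp (a $ k + s * b $ k))) = r *\<^sub>R c'' s" for r
      by (simp add: c''_def vec_eq_iff)
    ultimately show ?thesis by (simp add: has_vector_derivative_def)
  qed
  note dB = has_grad_hess_along_curve(1)[where c = c and c' = c', OF B cS dc dc']
  note dG = has_grad_hess_along_curve(2)[where c = c and c' = c', OF B cS dc dc']
  have B0: "0 < B (c s)" for s using pos[OF cS] .
  have "convex_on UNIV (\<lambda>s. ln (B (c s)))"
  proof (rule convex_onI)
    fix t r s :: real assume t: "0 < t" "t < 1"
    have "c ((1 - t) *\<^sub>R r + t *\<^sub>R s)
        = (\<chi> k. exp (((1 - t) *\<^sub>R (a + r *\<^sub>R b) + t *\<^sub>R (a + s *\<^sub>R b)) $ k))"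
      by (simp add: c_def vec_eq_iff algebra_simps)
    then show "ln (B (c ((1 - t) *\<^sub>R r + t *\<^sub>R s))) \<le> (1 - t) * ln (B (c r)) + t * ln (B (c s))"
      using convex_onD[OF cvx, of t "a + r *\<^sub>R b" "a + s *\<^sub>R b"] t by (simp add: c_def)
  qed simp
  moreover have "((\<lambda>s. ln (B (c s))) has_real_derivative (G (c s) \<bullet> c' s) / B (c s)) (at s)" for s
    using B0 by (auto intro!: derivative_eq_intros dB)
  moreover have "((\<lambda>s. (G (c s) \<bullet> c' s) / B (c s)) has_real_derivative
      ((c' 0 \<bullet> (H (c 0) *v c' 0) + G (c 0) \<bullet> c'' 0) * B (c 0)
        - (G (c 0) \<bullet> c' 0) * (G (c 0) \<bullet> c' 0)) / (B (c 0) * B (c 0))) (at 0)"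
    using B0[of 0] by (intro DERIV_divide dB dG) simp
  ultimately have "0 \<le> ((c' 0 \<bullet> (H (c 0) *v c' 0) + G (c 0) \<bullet> c'' 0) * B (c 0)
        - (G (c 0) \<bullet> c' 0) * (G (c 0) \<bullet> c' 0)) / (B (c 0) * B (c 0))"
    by (rule convex_second_derivative_nonneg)
  then have "0 \<le> (c' 0 \<bullet> (H (c 0) *v c' 0) + G (c 0) \<bullet> c'' 0) * B (c 0)
        - (G (c 0) \<bullet> c' 0) * (G (c 0) \<bullet> c' 0)"
    using pos_le_divide_eq[OF mult_pos_pos[OF B0[of 0] B0[of 0]], of 0] by simp
  then show ?thesis
    by (simp add: c0 inner_vec_def[of "G x" "vec_lambda _"] power2_eq_square mult.commute)
qed

text \<open>The right side of the hypothesis is the Hessian of \<open>ln \<circ> u\<close> at a point where \<open>u\<close> has gradient \<open>g\<close>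
and Hessian \<open>h\<close>.  The lower bound on it, a Li-Yau type inequality, limits the square of the gradient
by the second derivatives; this lemma is the trace version and the next one the directional version.\<close>

lemma log_hessian_bound_trace:
  assumes C: "positive_semidefinite C" and u: "0 < u"
    and L: "- (a *\<^sub>R A) \<le>\<^sub>p\<^sub>s\<^sub>d (1 / u) *\<^sub>R h - (1 / u\<^sup>2) *\<^sub>R outer g g"
  shows "(g \<bullet> (C *v g)) / u \<le> C \<bullet> h + a * u * (C \<bullet> A)"
proof -
  have "0 \<le> C \<bullet> ((1 / u) *\<^sub>R h - (1 / u\<^sup>2) *\<^sub>R outer g g - - (a *\<^sub>R A))"
    using L by (intro positive_semidefinite_inner_nonneg[OF C]) (simp add: psd_le_def)
  also have "\<dots> = (C \<bullet> h - (g \<bullet> (C *v g)) / u + a * u * (C \<bullet> A)) / u"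
    using u by (simp add: inner_diff_right inner_add_right inner_outer field_simps power2_eq_square)
  finally show ?thesis using u by (simp add: zero_le_divide_iff)
qed

lemma log_hessian_bound_quadratic:
  assumes u: "0 < u" and L: "- (a *\<^sub>R A) \<le>\<^sub>p\<^sub>s\<^sub>d (1 / u) *\<^sub>R h - (1 / u\<^sup>2) *\<^sub>R outer g g"
  shows "(g \<bullet> v)\<^sup>2 / u \<le> v \<bullet> (h *v v) + a * u * (v \<bullet> (A *v v))"
proof -
  have "0 \<le> v \<bullet> (((1 / u) *\<^sub>R h - (1 / u\<^sup>2) *\<^sub>R outer g g - - (a *\<^sub>R A)) *v v)"
    using L by (simp add: psd_le_def positive_semidefinite_def)
  also have "\<dots> = (v \<bullet> (h *v v) - (g \<bullet> v)\<^sup>2 / u + a * u * (v \<bullet> (A *v v))) / u"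
    using u by (simp add: matrix_vector_mult_diff_rdistrib matrix_vector_mult_add_rdistrib
        scaleR_matrix_vector_assoc[symmetric] outer_mult_vector inner_diff_right inner_add_right
        inner_commute[of v g] field_simps power2_eq_square)
  finally show ?thesis using u by (simp add: zero_le_divide_iff)
qed

section \<open>The transformed supersolution\<close>

theorem theorem3p3:
  fixes A :: "real^'n^'n::finite"
    and B :: "real^'m::finite \<Rightarrow> real"
    and lam :: real
    and u :: "'m \<Rightarrow> real \<Rightarrow> real^'n \<Rightarrow> real"
  assumes A_posdef: "positive_definite A"
    and B_pos: "\<And>x. x \<in> positive_orthant \<Longrightarrow> 0 < B x"
    and B_diff: "twice_differentiable_on B positive_orthant"
    and B_incr: "\<And>j x. x \<in> positive_orthant \<Longrightarrow> 0 \<le> partial_derivative j B x"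
    and lam_nonneg: "0 \<le> lam"
    and B_hess: "\<And>x. x \<in> positive_orthant \<Longrightarrow>
          hessian B x \<le>\<^sub>p\<^sub>s\<^sub>d lam *\<^sub>R diag_matrix (\<chi> j. partial_derivative j B x / x $ j)"
    and u_pos: "\<And>j t x. 0 < t \<Longrightarrow> 0 < u j t x"
    and u_C1_t: "\<And>j x. (\<lambda>t. u j t x) C1_differentiable_on {0<..}"
    and u_C2_x: "\<And>j t. 0 < t \<Longrightarrow> C2_differentiable_on (u j t) UNIV"
    and u_pde: "\<And>j t x. 0 < t \<Longrightarrow>
          deriv (\<lambda>s. u j s x) t \<ge> divergence (\<lambda>y. matrix_inv A *v gradient (u j t) y) x"
    and u_hess: "\<And>j t x. 0 < t \<Longrightarrow>
          - ((1 / (2 * t)) *\<^sub>R A) \<le>\<^sub>p\<^sub>s\<^sub>d hessian (\<lambda>y. ln (u j t y)) x"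
  shows "let v = (\<lambda>t x. t powr (lam * real CARD('n) / 2) * B (\<chi> j. u j t x));
             \<Theta> = (\<lambda>x::real^'m. ln (B (\<chi> j. exp (x $ j))))
         in (\<forall>t>0. \<forall>x. deriv (\<lambda>s. v s x) t
                  \<ge> 1 / (1 + lam) * divergence (\<lambda>y. matrix_inv A *v gradient (v t) y) x)
          \<and> (convex_on UNIV \<Theta> \<longrightarrow>
               (\<forall>t>0. \<forall>x. - ((1 / (2 * t)) *\<^sub>R A)
                  \<le>\<^sub>p\<^sub>s\<^sub>d (1 / (1 + lam)) *\<^sub>R hessian (\<lambda>y. ln (v t y)) x))"
proof -
  define \<alpha> where "\<alpha> = lam * real CARD('n) / 2"
  define v where "v = (\<lambda>t x. t powr \<alpha> * B (\<chi> j. u j t x))"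
  define C where "C = matrix_inv A"
  have C: "positive_semidefinite C" and CA: "C \<bullet> A = real CARD('n)"
    using positive_definite_inverse[OF A_posdef] by (auto simp: C_def)
  have B: "has_grad_hess B (gradient B) (hessian B) positive_orthant"
    using B_diff by (rule twice_differentiable_on_imp_has_grad_hess)
  have B_bound: "hessian B x \<le>\<^sub>p\<^sub>s\<^sub>d lam *\<^sub>R diag_matrix (\<chi> j. gradient B x $ j / x $ j)"
    if "x \<in> positive_orthant" for x
    using B_hess[OF that] by (simp add: gradient_def)
  have "1 / (1 + lam) * divergence (\<lambda>y. C *v gradient (v t) y) x \<le> deriv (\<lambda>s. v s x) t
      \<and> (convex_on UNIV (\<lambda>x. ln (B (\<chi> j. exp (x $ j)))) \<longrightarrow>
          - ((1 / (2 * t)) *\<^sub>R A) \<le>\<^sub>p\<^sub>s\<^sub>d (1 / (1 + lam)) *\<^sub>R hessian (\<lambda>y. ln (v t y)) x)"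
    if t: "0 < t" for t x
  proof -
    define U where "U y = (\<chi> j. u j t y)" for y
    define J where "J = (\<chi> j. gradient (u j t) x)"
    define h where "h = (\<lambda>j. hessian (u j t) x)"
    define b where "b = gradient B (U x)"
    define a where "a = 1 / (2 * t)"
    define c where "c = t powr \<alpha>"
    define M where "M = transpose J ** hessian B (U x) ** J + (\<Sum>j\<in>UNIV. b $ j *\<^sub>R h j)"
    have U_orth: "U y \<in> positive_orthant" for y
      using u_pos[OF t] by (simp add: U_def positive_orthant_def)
    have Uk: "0 < U x $ j" for j
      using U_orth[of x] by (simp add: positive_orthant_def)
    have b_nonneg: "0 \<le> b $ j" for j
      using B_incr[OF U_orth] by (simp add: b_def gradient_def)
    have c_pos: "0 < c" using t by (simp add: c_def)
    have a_pos: "0 < a" using t by (simp add: a_def)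
    have ghu: "has_grad_hess (u j t) (gradient (u j t)) (hessian (u j t)) UNIV" for j
      using u_C2_x[OF t, of j]
      by (intro twice_differentiable_on_imp_has_grad_hess) (simp add: C2_differentiable_on_def)
    note ghv = has_grad_hess_cmult[where c = c, OF has_grad_hess_compose[where U = "\<lambda>j. u j t",
          OF B ghu U_orth[unfolded U_def]], folded U_def]
    have v_eq: "v t = (\<lambda>y. c * B (U y))"
      by (simp add: v_def c_def U_def)
    note ghv = ghv[folded v_eq]
    have v_pos: "0 < v t y" for y
      using c_pos B_pos[OF U_orth] by (simp add: v_eq)
    have log_u: "- (a *\<^sub>R A) \<le>\<^sub>p\<^sub>s\<^sub>d (1 / U x $ j) *\<^sub>R h j - (1 / (U x $ j)\<^sup>2) *\<^sub>R outer (J $ j) (J $ j)" for j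
      using u_hess[OF t, of j x] has_grad_hess_UNIV_unique(2)[OF has_grad_hess_ln[OF ghu u_pos[OF t]]]
      by (simp add: a_def U_def h_def J_def)
    have euler: "(\<Sum>j\<in>UNIV. b $ j * U x $ j) \<le> (1 + lam) * B (U x)"
      using diagonal_hessian_bound_imp_euler[OF B B_pos B_bound lam_nonneg U_orth]
      by (simp add: inner_vec_def b_def)

    \<comment> \<open>the supersolution property: \<open>M\<close> is the Hessian of \<open>B \<circ> U\<close> at \<open>x\<close>\<close>
    have div: "divergence (\<lambda>y. C *v gradient (v t) y) x = c * (C \<bullet> M)"
      using divergence_matrix_gradient[OF ghv, of C x]
      by (simp add: M_def J_def h_def b_def)
    have M_trace: "C \<bullet> M \<le> lam * (\<Sum>j\<in>UNIV. b $ j * (C \<bullet> h j + a * U x $ j * real CARD('n)))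
        + (\<Sum>j\<in>UNIV. b $ j * (C \<bullet> h j))"
    proof -
      have "C \<bullet> (transpose J ** hessian B (U x) ** J)
          \<le> lam * (\<Sum>j\<in>UNIV. b $ j / U x $ j * (J $ j \<bullet> (C *v J $ j)))"
        using inner_congruence_le[OF C B_bound[OF U_orth]] by (simp add: b_def)
      also have "\<dots> \<le> lam * (\<Sum>j\<in>UNIV. b $ j * (C \<bullet> h j + a * U x $ j * real CARD('n)))"
      proof (intro mult_left_mono sum_mono lam_nonneg)
        fix j
        show "b $ j / U x $ j * (J $ j \<bullet> (C *v J $ j))
            \<le> b $ j * (C \<bullet> h j + a * U x $ j * real CARD('n))"
          using mult_left_mono[OF log_hessian_bound_trace[OF C Uk[of j] log_u] b_nonneg[of j]]
          by (simp add: CA)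
      qed
      finally show ?thesis by (simp add: M_def inner_add_right inner_sum_right)
    qed
    define d where "d = (\<lambda>j. deriv (\<lambda>s. u j s x) t)"
    have pde: "C \<bullet> h j \<le> d j" for j
      using u_pde[OF t, of j x] divergence_matrix_gradient[OF ghu, where x = x]
      by (simp add: C_def h_def d_def)
    have du: "((\<lambda>s. u j s x) has_real_derivative d j) (at t)" for j
    proof -
      have "(\<lambda>s. u j s x) differentiable (at t)"
        using u_C1_t[of j x] t by (simp add: C1_differentiable_on_eq)
      then show ?thesis
        by (simp add: d_def DERIV_deriv_iff_real_differentiable)
    qed
    have dv: "deriv (\<lambda>s. v s x) t = c * (\<alpha> / t * B (U x) + (\<Sum>j\<in>UNIV. b $ j * d j))"
      using has_real_derivative_powr_times_compose[OF B U_orth[of x, unfolded U_def] t du, of \<alpha>]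
      unfolding v_def by (simp add: DERIV_imp_deriv U_def b_def c_def)
    \<comment> \<open>the error term with the dimension is absorbed by the time derivative of the power of \<open>t\<close>\<close>
    have "divergence (\<lambda>y. C *v gradient (v t) y) x \<le> (1 + lam) * deriv (\<lambda>s. v s x) t"
    proof -
      let ?n = "real CARD('n)"
      have "C \<bullet> M \<le> (1 + lam) * (\<Sum>j\<in>UNIV. b $ j * (C \<bullet> h j))
          + lam * a * ?n * (\<Sum>j\<in>UNIV. b $ j * U x $ j)"
        using M_trace by (simp add: algebra_simps sum.distrib sum_distrib_left)
      also have "\<dots> \<le> (1 + lam) * (\<Sum>j\<in>UNIV. b $ j * d j) + lam * a * ?n * ((1 + lam) * B (U x))"
        using lam_nonneg a_pos b_nonneg pde
        by (intro add_mono mult_left_mono sum_mono euler) auto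
      also have "\<dots> = (1 + lam) * (\<alpha> / t * B (U x) + (\<Sum>j\<in>UNIV. b $ j * d j))"
        by (simp add: a_def \<alpha>_def algebra_simps)
      finally show ?thesis
        using mult_left_mono[of _ _ c] c_pos by (simp add: div dv mult.left_commute)
    qed
    then have heat: "1 / (1 + lam) * divergence (\<lambda>y. C *v gradient (v t) y) x \<le> deriv (\<lambda>s. v s x) t"
      using lam_nonneg by (simp add: field_simps)

    have logv: "- ((1 / (2 * t)) *\<^sub>R A) \<le>\<^sub>p\<^sub>s\<^sub>d (1 / (1 + lam)) *\<^sub>R hessian (\<lambda>y. ln (v t y)) x"
      if cvx: "convex_on UNIV (\<lambda>x. ln (B (\<chi> j. exp (x $ j))))"
    proof -
      \<comment> \<open>the gradient of \<open>B \<circ> U\<close> at \<open>x\<close>\<close>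
      define g where "g = b v* J"
      let ?L = "hessian (\<lambda>y. ln (v t y)) x"
      have L: "?L = (1 / v t x) *\<^sub>R (c *\<^sub>R M) - (1 / (v t x)\<^sup>2) *\<^sub>R outer (c *\<^sub>R g) (c *\<^sub>R g)"
        using has_grad_hess_UNIV_unique(2)[OF has_grad_hess_ln[OF ghv v_pos]]
        by (simp add: M_def J_def h_def b_def g_def)
      have symA: "A $ i $ j = A $ j $ i" for i j
        using A_posdef by (auto simp: positive_definite_def symmetric_matrix_iff)
      have "symmetric_matrix (hessian B (U x))"
        using psd_le_diag_matrix_imp_symmetric[OF B_bound[OF U_orth]] .
      then have symJ: "(transpose J ** hessian B (U x) ** J) $ i $ j
          = (transpose J ** hessian B (U x) ** J) $ j $ i" for i j
        using symmetric_matrix_congruence[of "hessian B (U x)" J] by (simp add: symmetric_matrix_iff)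
      have symh: "h k $ i $ j = h k $ j $ i" for i j k
        using positive_semidefiniteD(1)[OF log_u[unfolded psd_le_def], of k i j] Uk[of k] symA[of i j]
        by (simp add: outer_def mult.commute)
      have symM: "M $ i $ j = M $ j $ i" for i j
        by (simp add: M_def symJ symh)
      have quad: "- (a * (1 + lam)) * (w \<bullet> (A *v w)) \<le> w \<bullet> (?L *v w)" for w
      proof -
        define p where "p = J *v w"
        have pk: "p $ k = J $ k \<bullet> w" for k by (simp add: p_def matrix_vector_mul_component)
        define q where "q = w \<bullet> (A *v w)"
        have q: "0 \<le> q"
          using A_posdef unfolding q_def positive_definite_def by (cases "w = 0") (auto simp: less_imp_le)
        have BU: "0 < B (U x)" using B_pos[OF U_orth] .
        have Mw: "w \<bullet> (M *v w) = p \<bullet> (hessian B (U x) *v p) + (\<Sum>k\<in>UNIV. b $ k * (w \<bullet> (h k *v w)))"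
          by (simp add: M_def p_def matrix_vector_mult_add_rdistrib inner_add_right congruence_quadratic)
             (simp add: inner_outer[symmetric] inner_sum_left)
        have gw: "g \<bullet> w = b \<bullet> p" by (simp add: g_def p_def dot_lmul_matrix)
        have "(\<Sum>k\<in>UNIV. b $ k * (p $ k)\<^sup>2 / U x $ k)
            \<le> (\<Sum>k\<in>UNIV. b $ k * (w \<bullet> (h k *v w) + a * U x $ k * q))"
        proof (rule sum_mono)
          fix k
          show "b $ k * (p $ k)\<^sup>2 / U x $ k \<le> b $ k * (w \<bullet> (h k *v w) + a * U x $ k * q)"
            using mult_left_mono[OF log_hessian_bound_quadratic[OF Uk[of k] log_u, of w] b_nonneg[of k]]
            by (simp add: pk q_def)
        qed
        also have "\<dots> = (\<Sum>k\<in>UNIV. b $ k * (w \<bullet> (h k *v w))) + a * q * (\<Sum>k\<in>UNIV. b $ k * U x $ k)"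
          by (simp add: algebra_simps sum.distrib sum_distrib_left)
        also have "\<dots> \<le> (\<Sum>k\<in>UNIV. b $ k * (w \<bullet> (h k *v w))) + a * q * ((1 + lam) * B (U x))"
          using a_pos q by (intro add_left_mono mult_left_mono euler) simp
        finally have "(b \<bullet> p)\<^sup>2 \<le> B (U x) * (w \<bullet> (M *v w) + a * q * ((1 + lam) * B (U x)))"
          using log_convex_second_order[OF B B_pos cvx U_orth, of x p] BU
          unfolding Mw b_def[symmetric]
          by (smt (verit, best) mult_left_mono)
        then have "- (a * (1 + lam)) * q \<le> (B (U x) * (w \<bullet> (M *v w)) - (b \<bullet> p)\<^sup>2) / (B (U x))\<^sup>2"
          using BU by (simp add: field_simps power2_eq_square)
        also have "\<dots> = w \<bullet> (?L *v w)"
          using BU c_pos unfolding L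
          by (simp add: v_eq matrix_vector_mult_diff_rdistrib inner_diff_right
              scaleR_matrix_vector_assoc[symmetric] outer_mult_vector gw inner_commute[of w g]
              field_simps power2_eq_square)
        finally show ?thesis by (simp add: q_def)
      qed
      let ?R = "(1 / (1 + lam)) *\<^sub>R ?L - - ((1 / (2 * t)) *\<^sub>R A)"
      have "symmetric_matrix ?R"
        by (simp add: symmetric_matrix_iff L outer_def symM symA mult.commute)
      moreover have "0 \<le> w \<bullet> (?R *v w)" for w
      proof -
        have "w \<bullet> (?R *v w) = (w \<bullet> (?L *v w)) / (1 + lam) + a * (w \<bullet> (A *v w))"
          by (simp add: matrix_vector_mult_add_rdistrib scaleR_matrix_vector_assoc[symmetric]
              inner_add_right a_def)
        also have "\<dots> = (w \<bullet> (?L *v w) + a * (1 + lam) * (w \<bullet> (A *v w))) / (1 + lam)"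
          using lam_nonneg by (simp add: field_simps)
        also have "\<dots> \<ge> 0"
          using quad[of w] lam_nonneg by (intro divide_nonneg_pos) auto
        finally show ?thesis .
      qed
      ultimately show ?thesis
        by (simp add: psd_le_def positive_semidefinite_def)
    qed
    show ?thesis using heat logv by simp
  qed
  then show ?thesis
    unfolding v_def C_def \<alpha>_def Let_def by blast
qed

end
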